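(* Let $\varepsilon>0$ and let $F$ be a finite graph that is not an independent set. For every finite comparability graph $G$, if $t(F,G)\le\left(\frac{\varepsilon}{2}\right)^{\chi(F)\,\alpha(F)^2}$, then there exists an $F$-free (moreover, $K_{\chi(F)}$-free) spanning subgraph of $G$ that is a comparability graph, obtained by deleting at most $\varepsilon|V(G)|^2$ edges.
   Context: Graphs are simple and undirected. The comparability graph of a poset $(P,\prec)$ (where $\prec$ is anti-reflexive and transitive) is the graph with vertex set $P$ in which $x,y$ are adjacent iff $x\prec y$ or $y\prec x$; a comparability graph is a graph arising in this way from some poset. $\chi(F)$ is the chromatic number and $\alpha(F)$ the independence number of $F$; $K_r$ is the complete graph on $r$ vertices. $t(F,G)$ is the probability that a uniformly random mapping $V(F)\to V(G)$ is a graph homomorphism (edge-preserving). $G$ is $F$-free if it has no (not necessarily induced) subgraph isomorphic to $F$. *)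

theory Defs
  imports "HOL-Probability.Probability"
begin

record 'a ugraph =
  verts :: "'a set"
  edges :: "'a set set"

definition simple_graph :: "'a ugraph \<Rightarrow> bool" where
  "simple_graph G \<longleftrightarrow> (\<forall>e\<in>edges G. e \<subseteq> verts G \<and> card e = 2)"

definition finite_graph :: "'a ugraph \<Rightarrow> bool" where
  "finite_graph G \<longleftrightarrow> simple_graph G \<and> finite (verts G)"

definition complete_graph :: "nat \<Rightarrow> nat ugraph" where
  "complete_graph r = \<lparr>verts = {..<r}, edges = {e. e \<subseteq> {..<r} \<and> card e = 2}\<rparr>"

definition strict_poset :: "'a set \<Rightarrow> ('a \<times> 'a) set \<Rightarrow> bool" where
  "strict_poset P r \<longleftrightarrow> r \<subseteq> P \<times> P \<and> irrefl r \<and> trans r"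

definition comparability_graph_of :: "'a set \<Rightarrow> ('a \<times> 'a) set \<Rightarrow> 'a ugraph" where
  "comparability_graph_of P r =
    \<lparr>verts = P, edges = {{x, y} | x y. x \<in> P \<and> y \<in> P \<and> ((x, y) \<in> r \<or> (y, x) \<in> r)}\<rparr>"

definition comparability_graph :: "'a ugraph \<Rightarrow> bool" where
  "comparability_graph G \<longleftrightarrow> (\<exists>P r. strict_poset P r \<and> G = comparability_graph_of P r)"

definition independent_set :: "'a ugraph \<Rightarrow> 'a set \<Rightarrow> bool" where
  "independent_set G S \<longleftrightarrow> S \<subseteq> verts G \<and> (\<forall>x\<in>S. \<forall>y\<in>S. {x, y} \<notin> edges G)"

definition independence_number :: "'a ugraph \<Rightarrow> nat" where
  "independence_number G = Max {card S | S. independent_set G S}"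

definition proper_colouring :: "'a ugraph \<Rightarrow> nat \<Rightarrow> ('a \<Rightarrow> nat) \<Rightarrow> bool" where
  "proper_colouring G k c \<longleftrightarrow>
    c \<in> verts G \<rightarrow> {..<k} \<and> (\<forall>x y. {x, y} \<in> edges G \<longrightarrow> c x \<noteq> c y)"

definition chromatic_number :: "'a ugraph \<Rightarrow> nat" where
  "chromatic_number G = (LEAST k. \<exists>c. proper_colouring G k c)"

definition graph_hom :: "'a ugraph \<Rightarrow> 'b ugraph \<Rightarrow> ('a \<Rightarrow> 'b) \<Rightarrow> bool" where
  "graph_hom F G f \<longleftrightarrow>
    f \<in> verts F \<rightarrow> verts G \<and> (\<forall>x y. {x, y} \<in> edges F \<longrightarrow> {f x, f y} \<in> edges G)"

text \<open>Mappings between vertex sets are represented by extensional functions, so that each mapping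
  is counted once. If there is no mapping from \<open>verts F\<close> to \<open>verts G\<close> (that is,
  \<open>verts G\<close> is empty and \<open>verts F\<close> is not) the density is \<open>0\<close>.\<close>

definition hom_density :: "'a ugraph \<Rightarrow> 'b ugraph \<Rightarrow> real" where
  "hom_density F G =
    measure (uniform_count_measure (verts F \<rightarrow>\<^sub>E verts G))
      {f \<in> verts F \<rightarrow>\<^sub>E verts G. graph_hom F G f}"

definition isomorphic :: "'a ugraph \<Rightarrow> 'b ugraph \<Rightarrow> bool" where
  "isomorphic F G \<longleftrightarrow>
    (\<exists>f. bij_betw f (verts F) (verts G) \<and>
      (\<forall>x\<in>verts F. \<forall>y\<in>verts F. {x, y} \<in> edges F \<longleftrightarrow> {f x, f y} \<in> edges G))"

definition subgraph :: "'a ugraph \<Rightarrow> 'a ugraph \<Rightarrow> bool" where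
  "subgraph H G \<longleftrightarrow> simple_graph H \<and> verts H \<subseteq> verts G \<and> edges H \<subseteq> edges G"

definition spanning_subgraph :: "'a ugraph \<Rightarrow> 'a ugraph \<Rightarrow> bool" where
  "spanning_subgraph H G \<longleftrightarrow> subgraph H G \<and> verts H = verts G"

definition graph_free :: "'a ugraph \<Rightarrow> 'b ugraph \<Rightarrow> bool" where
  "graph_free F G \<longleftrightarrow> \<not> (\<exists>H. subgraph H G \<and> isomorphic F H)"

end

theory Submission
  imports Defs
begin

text \<open>
  Let \<open>r\<close> be the order, \<open>n\<close> the number of vertices of \<open>G\<close>, \<open>k\<close> the chromatic number of \<open>F\<close>,
  \<open>a\<close> its independence number, and \<open>\<delta> = \<epsilon> / 2\<close>. Put every vertex in level \<open>0\<close>, and put a vertex in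
  level \<open>j + 1\<close> if at least \<open>\<delta> n\<close> vertices of level \<open>j\<close> lie below it. The levels decrease, and by
  transitivity each of them is closed upwards. Everything depends on the size of level \<open>k - 1\<close>.

  If level \<open>k - 1\<close> has at most \<open>\<delta> n\<close> vertices, delete all comparabilities that touch it and all
  comparabilities between vertices lying in exactly the same levels. The first kind costs at most
  \<open>\<delta> n\<^sup>2\<close> edges. So does the second: a vertex in level \<open>j\<close> but not in level \<open>j + 1\<close> has fewer than
  \<open>\<delta> n\<close> vertices of level \<open>j\<close> below it (\<open>card_removed_by_level_cut\<close>). What remains is again a strict
  order, because the levels are closed upwards (\<open>strict_poset_level_cut\<close>), and counting for each
  vertex the levels among \<open>1, \<dots>, k - 2\<close> that contain it gives a proper colouring of the
  comparability graph with \<open>k - 1\<close> colours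
  (\<open>proper_colouring_level_cut\<close>). A graph with such a colouring contains neither \<open>F\<close> nor the
  complete graph on \<open>k\<close> vertices.

  Otherwise, descending greedily from level \<open>k - 1\<close> to level \<open>0\<close> produces more than \<open>(\<delta> n)\<^sup>k\<close>
  chains \<open>x\<^sub>0 < \<dots> < x\<^sub>k\<^sub>-\<^sub>1\<close> (\<open>card_chains_ending_in_level\<close>), so the density \<open>p\<close> of such chains exceeds
  \<open>\<delta>\<^sup>k\<close>. It remains to see that the density of homomorphisms from \<open>F\<close> is at least \<open>p\<close> to the power
  \<open>a\<^sup>2\<close> (\<open>hom_density_ge_chain_density\<close>), since this contradicts the hypothesis. Colour \<open>F\<close> with \<open>k\<close>
  colours. All colours occur, and each class is independent, hence of size at most \<open>a\<close>. By
  transitivity, a map that sends each vertex of colour \<open>i\<close> below each vertex of colour \<open>i + 1\<close>, for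
  every \<open>i\<close>, sends vertices of different colours to comparable vertices, so it is a homomorphism.
  Such maps are the copies of a blow-up of a path on the \<open>k\<close> colours, and a path is bipartite with the
  even and the odd colours as its sides. With the images of the odd side fixed, the choices for the
  vertices of the even side are independent of each other, so replacing each even vertex by at most
  \<open>a\<close> copies turns a conditional density \<open>s\<close> into at least \<open>s\<^sup>a\<close>, and by Jensen's inequality
  the average is then at least the power \<open>a\<close> of the original average (\<open>one_sided_blowup\<close>). Doing the
  same on the other side gives the exponent \<open>a\<^sup>2\<close> (\<open>bipartite_blowup\<close>).
\<close>

section \<open>Means over finite sets\<close>

definition mean :: "'a set \<Rightarrow> ('a \<Rightarrow> real) \<Rightarrow> real" where
  "mean S f = (\<Sum>x\<in>S. f x) / real (card S)"

lemma mean_mono: "(\<And>x. x \<in> S \<Longrightarrow> f x \<le> g x) \<Longrightarrow> mean S f \<le> mean S g"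
  unfolding mean_def by (intro divide_right_mono sum_mono) auto

lemma mean_nonneg: "(\<And>x. x \<in> S \<Longrightarrow> 0 \<le> f x) \<Longrightarrow> 0 \<le> mean S f"
  unfolding mean_def by (intro divide_nonneg_nonneg sum_nonneg) auto

lemma mean_le_1: "(\<And>x. x \<in> S \<Longrightarrow> f x \<le> 1) \<Longrightarrow> mean S f \<le> 1"
  using sum_bounded_above[of S f 1] unfolding mean_def
  by (auto simp: divide_le_eq_1)

lemma mean_swap: "mean S (\<lambda>x. mean T (f x)) = mean T (\<lambda>y. mean S (\<lambda>x. f x y))"
  unfolding mean_def by (simp add: sum_divide_distrib[symmetric] sum.swap[of _ S T] mult.commute)

lemma mean_of_bool:
  assumes "finite S"
  shows "mean S (\<lambda>x. of_bool (P x)) = real (card {x\<in>S. P x}) / real (card S)"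
proof -
  have "S \<inter> {x. P x} = {x\<in>S. P x}" by auto
  with assms show ?thesis unfolding mean_def by simp
qed

lemma power_mean_le_mean_power:
  assumes "finite S" "S \<noteq> {}" "\<And>x. x \<in> S \<Longrightarrow> 0 \<le> f x"
  shows "mean S f ^ m \<le> mean S (\<lambda>x. f x ^ m)"
proof -
  have "convex_on {0::real..} (\<lambda>x. x ^ m)"
  proof (cases "even m")
    case True
    then show ?thesis by (rule convex_on_subset[OF convex_power_even]) auto
  qed (rule convex_power_odd)
  from convex_on_sum[OF assms(1,2) this, where a = "\<lambda>_. 1 / real (card S)" and y = f]
  show ?thesis using assms by (simp add: mean_def sum_divide_distrib)
qed

text \<open>The values of a uniformly random map at different points are independent, so the mean of a
  product of functions of single values is the product of the means.\<close>

lemma mean_PiE_prod: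
  assumes "finite A" "finite V"
  shows "mean (A \<rightarrow>\<^sub>E V) (\<lambda>f. \<Prod>i\<in>A. g i (f i)) = (\<Prod>i\<in>A. mean V (g i))"
proof -
  have "(\<Sum>f\<in>A \<rightarrow>\<^sub>E V. \<Prod>i\<in>A. g i (f i)) = (\<Prod>i\<in>A. \<Sum>v\<in>V. g i v)"
    using assms prod_sum_PiE[of A "\<lambda>_. V" g] by simp
  then show ?thesis
    using assms by (simp add: mean_def card_PiE prod_dividef)
qed

text \<open>A random map on a disjoint union is a pair of independent random maps on the two parts. This
  separates the two sides of a bipartite pattern.\<close>

lemma mean_PiE_Un:
  assumes "finite A" "finite B" "A \<inter> B = {}"
  shows "mean (A \<union> B \<rightarrow>\<^sub>E V) h
    = mean (A \<rightarrow>\<^sub>E V) (\<lambda>f. mean (B \<rightarrow>\<^sub>E V) (\<lambda>g. h (\<lambda>i. if i \<in> A then f i else g i)))"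
proof -
  have "(\<Sum>f\<in>A \<rightarrow>\<^sub>E V. \<Sum>g\<in>B \<rightarrow>\<^sub>E V. h (\<lambda>i. if i \<in> A then f i else g i))
      = (\<Sum>(f, g)\<in>(A \<rightarrow>\<^sub>E V) \<times> (B \<rightarrow>\<^sub>E V). h (\<lambda>i. if i \<in> A then f i else g i))"
    by (rule sum.cartesian_product)
  also have "\<dots> = sum h (A \<union> B \<rightarrow>\<^sub>E V)"
  proof (rule sum.reindex_bij_witness
      [where i = "\<lambda>f. (restrict f A, restrict f B)" and j = "\<lambda>(f, g) i. if i \<in> A then f i else g i"],
      goal_cases)
    case (1 p)
    then show ?case using assms(3) by (auto simp: PiE_iff extensional_def fun_eq_iff)
  next
    case (2 p)
    then show ?case by (auto simp: PiE_iff extensional_def)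
  next
    case (3 f)
    then show ?case by (auto simp: PiE_iff extensional_def fun_eq_iff)
  next
    case (4 f)
    then show ?case by (auto simp: PiE_iff)
  qed auto
  finally show ?thesis
    using assms
    by (simp add: mean_def card_PiE card_Un_disjoint power_add sum_divide_distrib[symmetric] mult.commute)
qed

section \<open>Blowing up a bipartite pattern\<close>

text \<open>Think of \<open>y\<close> as the images of the fixed side of a bipartite pattern, and of \<open>q i v y\<close> as the
  indicator that \<open>v\<close> is a legal image of the vertex \<open>i\<close> on the other side. Replacing each \<open>i\<close> by its
  fibre under \<open>c\<close> is cheap because, given \<open>y\<close>, the choices are independent: the conditional density
  \<open>\<Prod>i\<in>I. s i y\<close> becomes a product of powers of the numbers \<open>s i y\<close> with exponents at most \<open>a\<close>, which is
  at least the power \<open>a\<close> of the original as \<open>s i y\<close> lies between \<open>0\<close> and \<open>1\<close>. Convexity of the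
  power then moves the exponent outside the mean over \<open>y\<close>.\<close>

lemma one_sided_blowup:
  fixes q :: "'i \<Rightarrow> 'v \<Rightarrow> 'y \<Rightarrow> real"
  assumes fin: "finite V" "finite I" "finite U" "finite Y" "Y \<noteq> {}"
    and c: "c ` U \<subseteq> I" and fibre: "\<And>i. i \<in> I \<Longrightarrow> card {u\<in>U. c u = i} \<le> a"
    and q: "\<And>i v y. 0 \<le> q i v y" "\<And>i v y. q i v y \<le> 1"
  shows "mean Y (\<lambda>y. mean (I \<rightarrow>\<^sub>E V) (\<lambda>x. \<Prod>i\<in>I. q i (x i) y)) ^ a
    \<le> mean Y (\<lambda>y. mean (U \<rightarrow>\<^sub>E V) (\<lambda>f. \<Prod>u\<in>U. q (c u) (f u) y))"
proof -
  define s where "s i y = mean V (\<lambda>v. q i v y)" for i y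
  have s: "0 \<le> s i y" "s i y \<le> 1" for i y
    unfolding s_def using q by (auto intro: mean_nonneg mean_le_1)
  have I: "mean (I \<rightarrow>\<^sub>E V) (\<lambda>x. \<Prod>i\<in>I. q i (x i) y) = (\<Prod>i\<in>I. s i y)" for y
    unfolding s_def by (rule mean_PiE_prod[OF fin(2,1)])
  have U: "mean (U \<rightarrow>\<^sub>E V) (\<lambda>f. \<Prod>u\<in>U. q (c u) (f u) y) = (\<Prod>u\<in>U. s (c u) y)" for y
    unfolding s_def by (rule mean_PiE_prod[OF fin(3,1)])
  have fibres: "(\<Prod>u\<in>U. s (c u) y) = (\<Prod>i\<in>I. s i y ^ card {u\<in>U. c u = i})" for y
  proof -
    have "(\<Prod>u\<in>U. s (c u) y) = (\<Prod>i\<in>I. \<Prod>u\<in>{u\<in>U. c u = i}. s (c u) y)"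
      by (rule prod.group[OF fin(3,2) c, symmetric])
    also have "\<dots> = (\<Prod>i\<in>I. s i y ^ card {u\<in>U. c u = i})"
      by (intro prod.cong refl) simp
    finally show ?thesis .
  qed
  have "mean Y (\<lambda>y. \<Prod>i\<in>I. s i y) ^ a \<le> mean Y (\<lambda>y. (\<Prod>i\<in>I. s i y) ^ a)"
    by (rule power_mean_le_mean_power[OF fin(4,5)]) (auto intro: prod_nonneg s)
  also have "\<dots> \<le> mean Y (\<lambda>y. \<Prod>u\<in>U. s (c u) y)"
    unfolding fibres prod_power_distrib
    by (intro mean_mono prod_mono conjI power_decreasing fibre zero_le_power s)
  finally show ?thesis
    unfolding I U .
qed

text \<open>The blow-up is done one side at a time: first the side \<open>I\<close> with the images of \<open>J\<close> fixed,
  then the side \<open>J\<close> with the images of the enlarged side \<open>A\<close> fixed. Each step costs an exponent \<open>a\<close>.\<close>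

lemma bipartite_blowup:
  fixes w :: "'i \<Rightarrow> 'j \<Rightarrow> 'v \<Rightarrow> 'v \<Rightarrow> real"
  assumes fin: "finite V" "V \<noteq> {}" "finite I" "finite J" "finite A" "finite B"
    and c: "c ` A \<subseteq> I" "\<And>i. i \<in> I \<Longrightarrow> card {u\<in>A. c u = i} \<le> a"
    and d: "d ` B \<subseteq> J" "\<And>j. j \<in> J \<Longrightarrow> card {u\<in>B. d u = j} \<le> a"
    and w: "\<And>i j x y. 0 \<le> w i j x y" "\<And>i j x y. w i j x y \<le> 1"
  shows "mean (I \<rightarrow>\<^sub>E V) (\<lambda>x. mean (J \<rightarrow>\<^sub>E V) (\<lambda>y. \<Prod>i\<in>I. \<Prod>j\<in>J. w i j (x i) (y j))) ^ a\<^sup>2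
    \<le> mean (A \<rightarrow>\<^sub>E V) (\<lambda>f. mean (B \<rightarrow>\<^sub>E V) (\<lambda>g. \<Prod>u\<in>A. \<Prod>v\<in>B. w (c u) (d v) (f u) (g v)))"
    (is "?p ^ a\<^sup>2 \<le> ?r")
proof -
  have nonempty: "finite (K \<rightarrow>\<^sub>E V)" "(K \<rightarrow>\<^sub>E V) \<noteq> {}" if "finite K" for K :: "'k set"
    using fin that by (auto simp: PiE_eq_empty_iff intro: finite_PiE)
  \<comment> \<open>the density of the half blow-up, in which only \<open>I\<close> has been replaced by \<open>A\<close>\<close>
  define t where "t = mean (J \<rightarrow>\<^sub>E V) (\<lambda>y. mean (A \<rightarrow>\<^sub>E V) (\<lambda>f. \<Prod>u\<in>A. \<Prod>j\<in>J. w (c u) j (f u) (y j)))"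
  have "?p = mean (J \<rightarrow>\<^sub>E V) (\<lambda>y. mean (I \<rightarrow>\<^sub>E V) (\<lambda>x. \<Prod>i\<in>I. \<Prod>j\<in>J. w i j (x i) (y j)))"
    by (rule mean_swap)
  moreover have "\<dots> ^ a \<le> t"
    unfolding t_def using fin c
    by (intro one_sided_blowup[where q = "\<lambda>i v y. \<Prod>j\<in>J. w i j v (y j)"] nonempty prod_nonneg prod_le_1)
      (auto simp: w)
  moreover have "0 \<le> ?p"
    by (intro mean_nonneg prod_nonneg) (auto simp: w)
  ultimately have p: "(?p ^ a) ^ a \<le> t ^ a"
    by (intro power_mono) auto
  have "t = mean (A \<rightarrow>\<^sub>E V) (\<lambda>f. mean (J \<rightarrow>\<^sub>E V) (\<lambda>y. \<Prod>j\<in>J. \<Prod>u\<in>A. w (c u) j (f u) (y j)))"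
    unfolding t_def by (subst mean_swap, subst prod.swap) (rule refl)
  moreover have "\<dots> ^ a \<le> mean (A \<rightarrow>\<^sub>E V) (\<lambda>f. mean (B \<rightarrow>\<^sub>E V) (\<lambda>g. \<Prod>v\<in>B. \<Prod>u\<in>A. w (c u) (d v) (f u) (g v)))"
    using fin d
    by (intro one_sided_blowup[where q = "\<lambda>j v f. \<Prod>u\<in>A. w (c u) j (f u) v"] nonempty prod_nonneg prod_le_1)
      (auto simp: w)
  moreover have "\<dots> = ?r"
    by (subst prod.swap) (rule refl)
  ultimately have "t ^ a \<le> ?r" by simp
  with p show ?thesis
    by (simp add: power2_eq_square power_mult)
qed

section \<open>Chains and their blow-ups\<close>

text \<open>The left-hand mean is the density of chains with \<open>k\<close> elements. A chain is determined by the
  relations between consecutive elements, and these form a bipartite pattern between even and odd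
  positions. A copy of its blow-up only relates vertices of consecutive colours; relations between
  colours further apart follow by transitivity through a vertex of every intermediate colour, which
  is why \<open>c\<close> has to attain all colours.\<close>

lemma chain_blowup:
  fixes r :: "('v \<times> 'v) set" and c :: "'u \<Rightarrow> nat"
  assumes fin: "finite V" "V \<noteq> {}" "finite U" and r: "trans r"
    and c: "c ` U = {..<k}" and fibre: "\<And>i. i < k \<Longrightarrow> card {u\<in>U. c u = i} \<le> a"
  shows "mean ({..<k} \<rightarrow>\<^sub>E V) (\<lambda>x. of_bool (\<forall>i. Suc i < k \<longrightarrow> (x i, x (Suc i)) \<in> r)) ^ a\<^sup>2
    \<le> mean (U \<rightarrow>\<^sub>E V) (\<lambda>f. of_bool (\<forall>u\<in>U. \<forall>v\<in>U. c u < c v \<longrightarrow> (f u, f v) \<in> r))"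
    (is "mean _ ?chain ^ _ \<le> mean _ ?lift")
proof -
  define I where "I = {i\<in>{..<k}. even i}"
  define J where "J = {i\<in>{..<k}. odd i}"
  define A where "A = {u\<in>U. even (c u)}"
  define B where "B = {u\<in>U. odd (c u)}"
  \<comment> \<open>the pattern between an even position \<open>i\<close> and an odd position \<open>j\<close>: trivial unless they are
     consecutive, and then oriented from the smaller to the larger one\<close>
  define w :: "nat \<Rightarrow> nat \<Rightarrow> 'v \<Rightarrow> 'v \<Rightarrow> real" where
    "w i j x y = of_bool ((j = Suc i \<longrightarrow> (x, y) \<in> r) \<and> (i = Suc j \<longrightarrow> (y, x) \<in> r))" for i j x y
  have k: "{..<k} = I \<union> J" "I \<inter> J = {}" "finite I" "finite J"
    unfolding I_def J_def by auto
  have U: "U = A \<union> B" "A \<inter> B = {}" "finite A" "finite B"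
    unfolding A_def B_def using fin by auto
  have chain: "?chain (\<lambda>i. if i \<in> I then x i else y i) \<le> (\<Prod>i\<in>I. \<Prod>j\<in>J. w i j (x i) (y j))" for x y
  proof (cases "\<forall>i. Suc i < k \<longrightarrow> ((if i \<in> I then x i else y i),
      (if Suc i \<in> I then x (Suc i) else y (Suc i))) \<in> r")
    case True
    have "w i j (x i) (y j) = 1" if "i \<in> I" "j \<in> J" for i j
    proof -
      have "(x i, y j) \<in> r" if "j = Suc i"
        using True[rule_format, of i] \<open>i \<in> I\<close> \<open>j \<in> J\<close> that by (auto simp: I_def J_def)
      moreover have "(y j, x i) \<in> r" if "i = Suc j"
        using True[rule_format, of j] \<open>i \<in> I\<close> \<open>j \<in> J\<close> that by (auto simp: I_def J_def)
      ultimately show ?thesis by (simp add: w_def)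
    qed
    then show ?thesis by simp
  next
    case False
    then have "?chain (\<lambda>i. if i \<in> I then x i else y i) = 0"
      by (simp only: of_bool_eq_0_iff not_False_eq_True)
    also have "0 \<le> (\<Prod>i\<in>I. \<Prod>j\<in>J. w i j (x i) (y j))"
      by (auto intro!: prod_nonneg simp: w_def)
    finally show ?thesis .
  qed
  have lift: "(\<Prod>u\<in>A. \<Prod>v\<in>B. w (c u) (c v) (f u) (g v)) \<le> ?lift (\<lambda>u. if u \<in> A then f u else g u)" for f g
  proof (cases "\<forall>u\<in>A. \<forall>v\<in>B. w (c u) (c v) (f u) (g v) = 1")
    case True
    let ?h = "\<lambda>u. if u \<in> A then f u else g u"
    have adjacent: "(?h u, ?h v) \<in> r" if "u \<in> U" "v \<in> U" "c v = Suc (c u)" for u v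
    proof (cases "even (c u)")
      case even: True
      then have "u \<in> A" "v \<in> B" "v \<notin> A" using that by (auto simp: A_def B_def)
      then show ?thesis using True[rule_format, of u v] that(3) by (simp add: w_def)
    next
      case False
      then have "u \<in> B" "v \<in> A" "u \<notin> A" using that by (auto simp: A_def B_def)
      then show ?thesis using True[rule_format, of v u] that(3) by (simp add: w_def)
    qed
    have "(?h u, ?h v) \<in> r" if "u \<in> U" "v \<in> U" "c v = Suc (c u + d)" for u v d
      using that
    proof (induction d arbitrary: v)
      case 0
      then show ?case using adjacent by auto
    next
      case (Suc d)
      have "c v < k" using Suc.prems(2) c by blast
      then have "Suc (c u + d) \<in> c ` U" unfolding c using Suc.prems(3) by simp
      then obtain t where "t \<in> U" "c t = Suc (c u + d)" by auto
      then show ?case using Suc.IH[of t] Suc.prems adjacent[of t v] r by (metis add_Suc_right transD)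
    qed
    then have "\<forall>u\<in>U. \<forall>v\<in>U. c u < c v \<longrightarrow> (?h u, ?h v) \<in> r"
      by (metis less_iff_Suc_add)
    moreover have "(\<Prod>u\<in>A. \<Prod>v\<in>B. w (c u) (c v) (f u) (g v)) \<le> 1"
      by (intro prod_le_1) (auto simp: w_def intro!: prod_nonneg prod_le_1)
    ultimately show ?thesis by simp
  next
    case False
    then obtain u v where uv: "u \<in> A" "v \<in> B" "w (c u) (c v) (f u) (g v) = 0"
      by (auto simp: w_def of_bool_def split: if_splits)
    then have "(\<Prod>v\<in>B. w (c u) (c v) (f u) (g v)) = 0"
      using U by auto
    then have "(\<Prod>u\<in>A. \<Prod>v\<in>B. w (c u) (c v) (f u) (g v)) = 0"
      using U uv(1) by (meson prod_zero_iff)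
    then show ?thesis by simp
  qed
  have "mean ({..<k} \<rightarrow>\<^sub>E V) ?chain
      \<le> mean (I \<rightarrow>\<^sub>E V) (\<lambda>x. mean (J \<rightarrow>\<^sub>E V) (\<lambda>y. \<Prod>i\<in>I. \<Prod>j\<in>J. w i j (x i) (y j)))"
    unfolding k(1) mean_PiE_Un[OF k(3,4,2)] by (intro mean_mono chain)
  then have "mean ({..<k} \<rightarrow>\<^sub>E V) ?chain ^ a\<^sup>2
      \<le> mean (I \<rightarrow>\<^sub>E V) (\<lambda>x. mean (J \<rightarrow>\<^sub>E V) (\<lambda>y. \<Prod>i\<in>I. \<Prod>j\<in>J. w i j (x i) (y j))) ^ a\<^sup>2"
    by (intro power_mono mean_nonneg) auto
  also have "\<dots> \<le> mean (A \<rightarrow>\<^sub>E V) (\<lambda>f. mean (B \<rightarrow>\<^sub>E V) (\<lambda>g. \<Prod>u\<in>A. \<Prod>v\<in>B. w (c u) (c v) (f u) (g v)))"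
  proof (rule bipartite_blowup[OF fin(1,2) k(3,4) U(3,4)])
    show "c ` A \<subseteq> I" "c ` B \<subseteq> J"
      unfolding A_def B_def I_def J_def using c by auto
    have "card {u\<in>A. c u = i} \<le> a" "card {u\<in>B. c u = i} \<le> a" if "i < k" for i
      using fin(3) by (auto intro!: order.trans[OF card_mono fibre[OF that]] simp: A_def B_def)
    then show "\<And>i. i \<in> I \<Longrightarrow> card {u\<in>A. c u = i} \<le> a" "\<And>i. i \<in> J \<Longrightarrow> card {u\<in>B. c u = i} \<le> a"
      by (auto simp: I_def J_def)
  qed (auto simp: w_def)
  also have "\<dots> \<le> mean (U \<rightarrow>\<^sub>E V) ?lift"
    unfolding mean_PiE_Un[OF U(3,4,2), folded U(1)] by (intro mean_mono lift)
  finally show ?thesis .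
qed

section \<open>Levels of a finite order\<close>

text \<open>For \<open>m = 1\<close>, level \<open>j\<close> consists of the vertices of height at least \<open>j\<close>. A larger \<open>m\<close> requires
  many predecessors instead of one, so that a vertex of level \<open>j\<close> is the top of many chains with
  \<open>j + 1\<close> elements, and a vertex that misses the next level can be separated from its own level at
  the price of few relations.\<close>

primrec level :: "'v set \<Rightarrow> ('v \<times> 'v) set \<Rightarrow> real \<Rightarrow> nat \<Rightarrow> 'v set" where
  "level V r m 0 = V"
| "level V r m (Suc j) = {v\<in>V. m \<le> real (card {u \<in> level V r m j. (u, v) \<in> r})}"

lemma level_subset: "level V r m j \<subseteq> V"
  by (cases j) auto

declare level.simps(2) [simp del]

lemma level_Suc_subset:
  assumes "finite V"
  shows "level V r m (Suc j) \<subseteq> level V r m j"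
proof (induction j)
  case 0
  show ?case using level_subset by simp
next
  case (Suc j)
  show ?case
  proof
    fix v assume v: "v \<in> level V r m (Suc (Suc j))"
    then have "m \<le> real (card {u \<in> level V r m (Suc j). (u, v) \<in> r})"
      by (simp add: level.simps(2)[of V r m "Suc j"])
    also have "card {u \<in> level V r m (Suc j). (u, v) \<in> r} \<le> card {u \<in> level V r m j. (u, v) \<in> r}"
      using Suc finite_subset[OF level_subset assms] by (intro card_mono) auto
    finally show "v \<in> level V r m (Suc j)"
      using v level_subset[of V r m "Suc (Suc j)"] by (auto simp: level.simps(2)[of V r m j])
  qed
qed

lemma level_antimono:
  assumes "finite V" "i \<le> j"
  shows "level V r m j \<subseteq> level V r m i"
  by (rule lift_Suc_antimono_le[where f = "level V r m", OF level_Suc_subset[OF assms(1)] assms(2)])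

text \<open>A vertex inherits by transitivity all predecessors of the vertices below it.\<close>

lemma level_upward_closed:
  assumes "finite V" "r \<subseteq> V \<times> V" "trans r" "(u, v) \<in> r" "u \<in> level V r m j"
  shows "v \<in> level V r m j"
proof (cases j)
  case 0
  with assms show ?thesis by auto
next
  case (Suc i)
  have "card {t \<in> level V r m i. (t, u) \<in> r} \<le> card {t \<in> level V r m i. (t, v) \<in> r}"
    using assms finite_subset[OF level_subset assms(1)] by (intro card_mono) (auto intro: transD[OF assms(3) _ assms(4)])
  with assms Suc show ?thesis by (auto simp: level.simps(2))
qed

text \<open>The chains are built from the top: each of the \<open>j\<close> downward steps, from a vertex in a level
  \<open>i + 1\<close> to one below it in level \<open>i\<close>, leaves at least \<open>m\<close> choices. The top element is confined to a
  set \<open>T\<close> so that the induction can be applied to the predecessors of a fixed vertex.\<close>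

lemma card_chains_ending_in_level:
  assumes "finite V" "0 \<le> m" "T \<subseteq> level V r m j"
  shows "real (card T) * m ^ j
    \<le> real (card {x \<in> {..<Suc j} \<rightarrow>\<^sub>E V. (\<forall>i<j. (x i, x (Suc i)) \<in> r) \<and> x j \<in> T})"
  using assms(3)
proof (induction j arbitrary: T)
  case 0
  have "inj_on (\<lambda>v. \<lambda>i\<in>{..<Suc 0}. v) T"
    by (rule inj_onI) (drule fun_cong[where x = 0], simp)
  moreover have "finite {x \<in> {..<Suc 0} \<rightarrow>\<^sub>E V. x 0 \<in> T}"
    using assms(1) by (simp add: finite_PiE)
  ultimately have "card T \<le> card {x \<in> {..<Suc 0} \<rightarrow>\<^sub>E V. x 0 \<in> T}"
    using 0 by (intro card_inj_on_le) (auto simp: PiE_iff)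
  then show ?case by simp
next
  case (Suc j)
  define C where "C i S = {x \<in> {..<Suc i} \<rightarrow>\<^sub>E V. (\<forall>h<i. (x h, x (Suc h)) \<in> r) \<and> x i \<in> S}" for i S
  define D where "D v = {u \<in> level V r m j. (u, v) \<in> r}" for v
  have fin: "finite (C i S)" for i S
    unfolding C_def using assms(1) by (simp add: finite_PiE)
  have finT: "finite T"
    using Suc.prems level_subset assms(1) by (metis finite_subset)
  have "real (card T) * m ^ Suc j = (\<Sum>v\<in>T. m * m ^ j)"
    by simp
  also have "\<dots> \<le> (\<Sum>v\<in>T. real (card (C j (D v))))"
  proof (rule sum_mono)
    fix v assume "v \<in> T"
    then have "m \<le> real (card (D v))" using Suc.prems by (auto simp: D_def level.simps(2))
    then have "m * m ^ j \<le> real (card (D v)) * m ^ j"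
      using assms(2) by (intro mult_right_mono) auto
    also have "\<dots> \<le> real (card (C j (D v)))"
      unfolding C_def by (rule Suc.IH) (auto simp: D_def)
    finally show "m * m ^ j \<le> real (card (C j (D v)))" .
  qed
  also have "\<dots> = real (card (Sigma T (\<lambda>v. C j (D v))))"
    using finT fin by simp
  also have "card (Sigma T (\<lambda>v. C j (D v))) \<le> card (C (Suc j) T)"
  proof (rule card_inj_on_le[where f = "\<lambda>(v, x). x(Suc j := v)"])
    show "inj_on (\<lambda>(v, x). x(Suc j := v)) (Sigma T (\<lambda>v. C j (D v)))"
    proof (rule inj_onI, clarsimp)
      fix v x v' x'
      assume eq: "x(Suc j := v) = x'(Suc j := v')" and "x \<in> C j (D v)" "x' \<in> C j (D v')"
      then have "x (Suc j) = undefined" "x' (Suc j) = undefined"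
        by (auto simp: C_def PiE_iff extensional_def)
      moreover have "(x(Suc j := v)) (Suc j) = (x'(Suc j := v')) (Suc j)"
        "(x(Suc j := v))(Suc j := undefined) = (x'(Suc j := v'))(Suc j := undefined)"
        unfolding eq by (rule refl)+
      ultimately show "v = v' \<and> x = x'"
        by (simp add: fun_upd_idem)
    qed
    show "(\<lambda>(v, x). x(Suc j := v)) ` Sigma T (\<lambda>v. C j (D v)) \<subseteq> C (Suc j) T"
    proof clarsimp
      fix v x assume v: "v \<in> T" and x: "x \<in> C j (D v)"
      have "v \<in> V" using subset_trans[OF Suc.prems level_subset] v by (rule subsetD)
      then have "x(Suc j := v) \<in> {..<Suc (Suc j)} \<rightarrow>\<^sub>E V"
        using x by (auto simp: C_def PiE_iff extensional_def less_Suc_eq)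
      moreover have "(x j, v) \<in> r" "\<forall>i<j. (x i, x (Suc i)) \<in> r"
        using x by (auto simp: C_def D_def)
      ultimately show "x(Suc j := v) \<in> C (Suc j) T"
        using v by (simp add: C_def less_Suc_eq)
    qed
  qed (rule fin)
  finally show ?case by (simp add: C_def)
qed

section \<open>Cutting the order at its levels\<close>

text \<open>A relation \<open>(u, v)\<close> survives if \<open>v\<close>, and hence also \<open>u\<close>, lies outside level \<open>l\<close> and if some level
  separates \<open>u\<close> from \<open>v\<close>.\<close>

definition level_cut :: "'v set \<Rightarrow> ('v \<times> 'v) set \<Rightarrow> real \<Rightarrow> nat \<Rightarrow> ('v \<times> 'v) set" where
  "level_cut V r m l = {(u, v) \<in> r. v \<notin> level V r m l \<and> (\<exists>j. v \<in> level V r m j \<and> u \<notin> level V r m j)}"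

lemma level_cut_subset: "level_cut V r m l \<subseteq> r"
  unfolding level_cut_def by auto

text \<open>A level that contains \<open>t\<close> but not \<open>v\<close> cannot contain any \<open>u\<close> below \<open>v\<close>, since levels are closed
  upwards; so the surviving relation is still transitive.\<close>

lemma strict_poset_level_cut:
  assumes "finite V" "strict_poset V r"
  shows "strict_poset V (level_cut V r m l)"
proof -
  have r: "r \<subseteq> V \<times> V" "irrefl r" "trans r"
    using assms(2) unfolding strict_poset_def by auto
  have "trans (level_cut V r m l)"
  proof (rule transI)
    fix u v t assume uv: "(u, v) \<in> level_cut V r m l" and vt: "(v, t) \<in> level_cut V r m l"
    then obtain j where j: "t \<in> level V r m j" "v \<notin> level V r m j"
      unfolding level_cut_def by auto
    have "u \<notin> level V r m j"
      using level_upward_closed[OF assms(1) r(1,3), of u v m j] uv j(2) level_cut_subset by blast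
    with uv vt j(1) show "(u, t) \<in> level_cut V r m l"
      using transD[OF r(3)] unfolding level_cut_def by blast
  qed
  with r show ?thesis
    unfolding strict_poset_def irrefl_def using level_cut_subset by blast
qed

text \<open>The colour of a vertex is the number of levels \<open>j\<close> with \<open>1 \<le> j < l\<close> that contain it. It
  strictly increases along surviving relations: the separating level is not level \<open>0\<close>, which contains
  every vertex, and comes before level \<open>l\<close>, because levels decrease and the larger vertex is not in
  level \<open>l\<close>.\<close>

lemma proper_colouring_level_cut:
  assumes "finite V" "strict_poset V r" "0 < l"
  shows "\<exists>h. proper_colouring (comparability_graph_of V (level_cut V r m l)) l h"
proof -
  define S where "S v = {j\<in>{1..<l}. v \<in> level V r m j}" for v
  have r: "r \<subseteq> V \<times> V" "trans r"
    using assms(2) unfolding strict_poset_def by auto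
  have less: "card (S u) < card (S v)" if uv: "(u, v) \<in> level_cut V r m l" for u v
  proof (rule psubset_card_mono)
    obtain j where j: "v \<in> level V r m j" "u \<notin> level V r m j" "(u, v) \<in> r" "v \<notin> level V r m l"
      using uv unfolding level_cut_def by auto
    have "S u \<subseteq> S v"
      using level_upward_closed[OF assms(1) r j(3)] unfolding S_def by auto
    moreover have "j \<in> S v - S u"
    proof -
      have "j \<noteq> 0"
        using j(2,3) r(1) by (cases j) auto
      moreover have "j < l"
        using j(1,4) level_antimono[OF assms(1)] by (meson not_less subsetD)
      ultimately show ?thesis using j unfolding S_def by auto
    qed
    ultimately show "S u \<subset> S v" by blast
  qed (simp add: S_def)
  have "card (S v) < l" for v
  proof -
    have "card (S v) \<le> card {1..<l}" unfolding S_def by (intro card_mono) auto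
    with assms(3) show ?thesis by simp
  qed
  then have "proper_colouring (comparability_graph_of V (level_cut V r m l)) l (\<lambda>v. card (S v))"
    unfolding proper_colouring_def comparability_graph_of_def
    by (auto simp: doubleton_eq_iff dest!: less)
  then show ?thesis by blast
qed

text \<open>The removed relations are counted by their larger vertex \<open>v\<close>. There are at most \<open>m\<close> vertices \<open>v\<close>
  in level \<open>l\<close>, with at most \<open>card V\<close> relations each. For any other \<open>v\<close>, let \<open>j\<close> be a level that
  contains \<open>v\<close> while the next one does not; the smaller vertices of removed relations lie in level \<open>j\<close>,
  and there are fewer than \<open>m\<close> of them.\<close>

lemma card_removed_by_level_cut:
  fixes m :: real
  assumes "finite V" "r \<subseteq> V \<times> V" "trans r" "0 \<le> m" "real (card (level V r m l)) \<le> m"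
  shows "real (card (r - level_cut V r m l)) \<le> 2 * m * real (card V)"
proof -
  define D where "D v = {u. (u, v) \<in> r - level_cut V r m l}" for v
  have D: "D v \<subseteq> V" for v
    using assms(2) unfolding D_def by auto
  have finD: "finite (D v)" for v
    using D assms(1) by (rule finite_subset)
  have bound: "real (card (D v)) \<le> m + (if v \<in> level V r m l then real (card V) else 0)" if "v \<in> V" for v
  proof (cases "v \<in> level V r m l")
    case True
    then show ?thesis using card_mono[OF assms(1) D[of v]] assms(4) by simp
  next
    case False
    have "\<exists>j. v \<in> level V r m j \<and> v \<notin> level V r m (Suc j)"
    proof (rule ccontr)
      assume "\<nexists>j. v \<in> level V r m j \<and> v \<notin> level V r m (Suc j)"
      then have "v \<in> level V r m j" for j
        using that by (induction j) auto
      with False show False by blast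
    qed
    then obtain j where j: "v \<in> level V r m j" "v \<notin> level V r m (Suc j)" by blast
    have "D v \<subseteq> {u \<in> level V r m j. (u, v) \<in> r}"
      using False j(1) unfolding D_def level_cut_def by auto
    then have "card (D v) \<le> card {u \<in> level V r m j. (u, v) \<in> r}"
      using finite_subset[OF level_subset assms(1)] by (intro card_mono) auto
    with j(2) that False show ?thesis by (simp add: level.simps(2))
  qed
  have "r - level_cut V r m l \<subseteq> (\<lambda>(v, u). (u, v)) ` Sigma V D"
    using assms(2) unfolding D_def by force
  then have "card (r - level_cut V r m l) \<le> card (Sigma V D)"
    using assms(1) finD by (intro surj_card_le) auto
  also have "\<dots> = (\<Sum>v\<in>V. card (D v))"
    using assms(1) finD by simp
  finally have "real (card (r - level_cut V r m l)) \<le> (\<Sum>v\<in>V. real (card (D v)))"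
    by (simp flip: of_nat_sum)
  also have "\<dots> \<le> (\<Sum>v\<in>V. m + (if v \<in> level V r m l then real (card V) else 0))"
    by (intro sum_mono bound)
  also have "\<dots> = real (card V) * m + real (card (level V r m l)) * real (card V)"
    using assms(1) level_subset[of V r m l]
    by (simp add: sum.distrib sum.If_cases Int_absorb1)
  also have "\<dots> \<le> real (card V) * m + m * real (card V)"
    using assms(5) by (intro add_left_mono mult_right_mono) auto
  finally show ?thesis by simp
qed

section \<open>Colourings\<close>

lemma proper_colouring_pullback:
  assumes "proper_colouring H m h" "subgraph H' H" "isomorphic F H'" "simple_graph F"
  shows "\<exists>c. proper_colouring F m c"
proof -
  obtain f where f: "bij_betw f (verts F) (verts H')"
    "\<forall>x\<in>verts F. \<forall>y\<in>verts F. {x, y} \<in> edges F \<longleftrightarrow> {f x, f y} \<in> edges H'"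
    using assms(3) unfolding isomorphic_def by blast
  have "f x \<in> verts H" if "x \<in> verts F" for x
    using f(1) assms(2) that unfolding subgraph_def by (auto dest: bij_betwE)
  moreover have "h (f x) \<noteq> h (f y)" if "{x, y} \<in> edges F" for x y
  proof -
    have "x \<in> verts F" "y \<in> verts F" using assms(4) that unfolding simple_graph_def by auto
    then have "{f x, f y} \<in> edges H" using f(2) that assms(2) unfolding subgraph_def by blast
    then show ?thesis using assms(1) unfolding proper_colouring_def by blast
  qed
  ultimately have "proper_colouring F m (h \<circ> f)"
    using assms(1) unfolding proper_colouring_def by auto
  then show ?thesis by blast
qed

lemma ex_proper_colouring:
  assumes "finite_graph F"
  shows "\<exists>k c. proper_colouring F k c"
proof -
  obtain c where c: "bij_betw c (verts F) {0..<card (verts F)}"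
    using assms ex_bij_betw_finite_nat unfolding finite_graph_def by blast
  have "c x \<noteq> c y" if "{x, y} \<in> edges F" for x y
  proof -
    have "x \<in> verts F" "y \<in> verts F" "x \<noteq> y"
      using assms that unfolding finite_graph_def simple_graph_def by force+
    then show ?thesis using c unfolding bij_betw_def inj_on_def by blast
  qed
  then have "proper_colouring F (card (verts F)) c"
    using bij_betwE[OF c] unfolding proper_colouring_def by auto
  then show ?thesis by blast
qed

lemma chromatic_number_le: "proper_colouring F k c \<Longrightarrow> chromatic_number F \<le> k"
  unfolding chromatic_number_def by (rule Least_le) blast

lemma proper_colouring_complete_graph: "proper_colouring (complete_graph r) k c \<Longrightarrow> r \<le> k"
proof -
  assume c: "proper_colouring (complete_graph r) k c"
  have "c x \<noteq> c y" if "x < r" "y < r" "x \<noteq> y" for x y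
    using c that unfolding proper_colouring_def complete_graph_def by simp
  then have "inj_on c {..<r}"
    by (auto simp: inj_on_def)
  moreover have "c ` {..<r} \<subseteq> {..<k}"
    using c unfolding proper_colouring_def complete_graph_def by auto
  ultimately show ?thesis
    using card_inj_on_le[of c "{..<r}" "{..<k}"] by simp
qed

text \<open>An optimal colouring uses every colour, because a missing colour could be closed up by shifting
  the larger ones down.\<close>

lemma optimal_colouring:
  assumes "finite_graph F"
  obtains c where "proper_colouring F (chromatic_number F) c" "c ` verts F = {..<chromatic_number F}"
proof -
  define k where "k = chromatic_number F"
  obtain c where c: "proper_colouring F k c"
    using LeastI_ex[OF ex_proper_colouring[OF assms]] unfolding k_def chromatic_number_def by blast
  have "j \<in> c ` verts F" if j: "j < k" for j
  proof (rule ccontr)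
    assume unused: "j \<notin> c ` verts F"
    define c' where "c' x = (if j < c x then c x - 1 else c x)" for x
    have "proper_colouring F (k - 1) c'"
      unfolding proper_colouring_def
    proof (intro conjI allI impI funcsetI)
      fix x assume x: "x \<in> verts F"
      then have "c x < k" "c x \<noteq> j" using c unused unfolding proper_colouring_def by auto
      with j show "c' x \<in> {..<k - 1}" unfolding c'_def by auto
    next
      fix x y assume xy: "{x, y} \<in> edges F"
      then have "x \<in> verts F" "y \<in> verts F"
        using assms unfolding finite_graph_def simple_graph_def by auto
      then have "c x \<noteq> j" "c y \<noteq> j" "c x \<noteq> c y"
        using c unused xy unfolding proper_colouring_def by auto
      then show "c' x \<noteq> c' y" unfolding c'_def by auto
    qed
    from chromatic_number_le[OF this] j show False unfolding k_def by simp
  qed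
  then have "c ` verts F = {..<k}"
    using c unfolding proper_colouring_def by auto
  with c that show ?thesis unfolding k_def by blast
qed

lemma chromatic_number_ge_2:
  assumes "finite_graph F" "\<not> independent_set F (verts F)"
  shows "2 \<le> chromatic_number F"
proof -
  obtain c where c: "proper_colouring F (chromatic_number F) c"
    using optimal_colouring[OF assms(1)] by blast
  obtain x y where "x \<in> verts F" "y \<in> verts F" "{x, y} \<in> edges F"
    using assms(2) unfolding independent_set_def by blast
  then have "c x < chromatic_number F" "c y < chromatic_number F" "c x \<noteq> c y"
    using c unfolding proper_colouring_def by auto
  then show ?thesis by linarith
qed

lemma card_le_independence_number:
  assumes "finite (verts F)" "independent_set F S"
  shows "card S \<le> independence_number F"
proof -
  have "{card S |S. independent_set F S} \<subseteq> card ` Pow (verts F)"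
    unfolding independent_set_def by auto
  then have "finite {card S |S. independent_set F S}"
    using assms(1) by (meson finite_Pow_iff finite_imageI finite_subset)
  then show ?thesis
    unfolding independence_number_def using assms(2) by (intro Max_ge) auto
qed

section \<open>Homomorphisms from chains\<close>

text \<open>An optimal colouring of \<open>F\<close> presents \<open>F\<close> as a subgraph of a blow-up of a chain, with classes of
  size at most the independence number. Each copy of this blow-up in the order is a homomorphism from
  \<open>F\<close> to the comparability graph.\<close>

lemma hom_density_ge_chain_density:
  fixes F :: "'a ugraph" and r :: "('b \<times> 'b) set"
  assumes F: "finite_graph F" and V: "finite V" "V \<noteq> {}" and r: "r \<subseteq> V \<times> V" "trans r"
  shows "mean ({..<chromatic_number F} \<rightarrow>\<^sub>E V)
      (\<lambda>x. of_bool (\<forall>i. Suc i < chromatic_number F \<longrightarrow> (x i, x (Suc i)) \<in> r)) ^ (independence_number F)\<^sup>2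
    \<le> hom_density F (comparability_graph_of V r)"
proof -
  let ?G = "comparability_graph_of V r"
  obtain c where c: "proper_colouring F (chromatic_number F) c"
      "c ` verts F = {..<chromatic_number F}"
    using optimal_colouring[OF F] .
  have finF: "finite (verts F)" and simpleF: "simple_graph F"
    using F unfolding finite_graph_def by auto
  have "card {u\<in>verts F. c u = i} \<le> independence_number F" for i
  proof (rule card_le_independence_number[OF finF])
    show "independent_set F {u\<in>verts F. c u = i}"
      using c(1) unfolding independent_set_def proper_colouring_def by force
  qed
  from chain_blowup[OF V finF r(2) c(2) this]
  have "mean ({..<chromatic_number F} \<rightarrow>\<^sub>E V)
      (\<lambda>x. of_bool (\<forall>i. Suc i < chromatic_number F \<longrightarrow> (x i, x (Suc i)) \<in> r)) ^ (independence_number F)\<^sup>2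
    \<le> mean (verts F \<rightarrow>\<^sub>E V) (\<lambda>f. of_bool (\<forall>u\<in>verts F. \<forall>v\<in>verts F. c u < c v \<longrightarrow> (f u, f v) \<in> r))" .
  also have "\<dots> \<le> mean (verts F \<rightarrow>\<^sub>E V) (\<lambda>f. of_bool (graph_hom F ?G f))"
  proof (rule mean_mono)
    fix f assume f: "f \<in> verts F \<rightarrow>\<^sub>E V"
    have "graph_hom F ?G f" if lift: "\<forall>u\<in>verts F. \<forall>v\<in>verts F. c u < c v \<longrightarrow> (f u, f v) \<in> r"
    proof -
      have "{f x, f y} \<in> edges ?G" if xy: "{x, y} \<in> edges F" for x y
      proof -
        have "x \<in> verts F" "y \<in> verts F" using simpleF xy unfolding simple_graph_def by auto
        moreover have "c x \<noteq> c y" using c(1) xy unfolding proper_colouring_def by blast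
        ultimately have "f x \<in> V" "f y \<in> V" "(f x, f y) \<in> r \<or> (f y, f x) \<in> r"
          using lift f by (auto simp: neq_iff)
        then show ?thesis unfolding comparability_graph_of_def by auto
      qed
      then show ?thesis
        using f unfolding graph_hom_def comparability_graph_of_def by auto
    qed
    then show "of_bool (\<forall>u\<in>verts F. \<forall>v\<in>verts F. c u < c v \<longrightarrow> (f u, f v) \<in> r)
        \<le> (of_bool (graph_hom F ?G f) :: real)"
      by simp
  qed
  also have "\<dots> = hom_density F ?G"
  proof -
    have "finite (verts F \<rightarrow>\<^sub>E V)" using finF V(1) by (rule finite_PiE)
    then show ?thesis
      by (simp add: mean_of_bool hom_density_def comparability_graph_of_def measure_uniform_count_measure)
  qed
  finally show ?thesis .
qed

section \<open>The removal lemma\<close>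

theorem theorem4p1:
  fixes \<epsilon> :: real and F :: "'a ugraph" and G :: "'b ugraph"
  assumes "\<epsilon> > 0"
    and "finite_graph F" and "\<not> independent_set F (verts F)"
    and "finite_graph G" and "comparability_graph G"
    and "hom_density F G \<le> (\<epsilon> / 2) ^ (chromatic_number F * (independence_number F)\<^sup>2)"
  shows "\<exists>H. spanning_subgraph H G \<and> comparability_graph H \<and>
    graph_free F H \<and> graph_free (complete_graph (chromatic_number F)) H \<and>
    real (card (edges G - edges H)) \<le> \<epsilon> * (real (card (verts G)))\<^sup>2"
proof -
  define k where "k = chromatic_number F"
  define a where "a = independence_number F"
  obtain V r where poset: "strict_poset V r" and G: "G = comparability_graph_of V r"
    using assms(5) unfolding comparability_graph_def by blast
  have r: "r \<subseteq> V \<times> V" "irrefl r" "trans r"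
    using poset unfolding strict_poset_def by auto
  have V: "finite V" "verts G = V"
    using assms(4) unfolding G finite_graph_def comparability_graph_of_def by auto
  define m where "m = \<epsilon> / 2 * real (card V)"
  have m: "0 \<le> m" unfolding m_def using assms(1) by simp
  have k: "2 \<le> k"
    unfolding k_def by (rule chromatic_number_ge_2[OF assms(2,3)])
  then obtain l where l: "k = Suc l" "0 < l" by (cases k) auto
  \<comment> \<open>If level \<open>l\<close> were larger, there would be too many chains with \<open>k\<close> elements, and hence too many
     homomorphisms from \<open>F\<close>. Here the strict inequality matters, as the hypothesis on the density is
     not strict.\<close>
  have few: "real (card (level V r m l)) \<le> m"
  proof (rule ccontr)
    assume many: "\<not> real (card (level V r m l)) \<le> m"
    then have n: "0 < card V" "V \<noteq> {}"
      using card_mono[OF V(1) level_subset[of V r m l]] m by (auto intro!: Nat.gr0I)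
    define p where "p = mean ({..<k} \<rightarrow>\<^sub>E V) (\<lambda>x. of_bool (\<forall>i. Suc i < k \<longrightarrow> (x i, x (Suc i)) \<in> r))"
    have "(\<epsilon> / 2 * real (card V)) ^ k = m * m ^ l"
      unfolding l m_def by simp
    also have "\<dots> < real (card (level V r m l)) * m ^ l"
      using many n assms(1) by (intro mult_strict_right_mono) (auto simp: m_def)
    also have "\<dots> \<le> card {x \<in> {..<k} \<rightarrow>\<^sub>E V. (\<forall>i<l. (x i, x (Suc i)) \<in> r) \<and> x l \<in> level V r m l}"
      unfolding l using card_chains_ending_in_level[OF V(1) m subset_refl] by simp
    also have "\<dots> \<le> card {x \<in> {..<k} \<rightarrow>\<^sub>E V. \<forall>i. Suc i < k \<longrightarrow> (x i, x (Suc i)) \<in> r}"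
      unfolding of_nat_le_iff using V(1) by (intro card_mono) (auto simp: l finite_PiE)
    also have "\<dots> = p * real (card V) ^ k"
      using V(1) n by (simp add: p_def mean_of_bool finite_PiE card_PiE)
    finally have "(\<epsilon> / 2) ^ k * real (card V) ^ k < p * real (card V) ^ k"
      by (simp only: power_mult_distrib)
    then have "(\<epsilon> / 2) ^ k < p"
      by (rule mult_right_less_imp_less) simp
    moreover have "0 < a"
    proof -
      obtain x where x: "x \<in> verts F"
        using assms(3) unfolding independent_set_def by blast
      have "independent_set F {x}"
        using x assms(2) unfolding independent_set_def finite_graph_def simple_graph_def by force
      then show ?thesis
        unfolding a_def using card_le_independence_number[of F "{x}"] assms(2)
        by (simp add: finite_graph_def)
    qed
    ultimately have "((\<epsilon> / 2) ^ k) ^ a\<^sup>2 < p ^ a\<^sup>2"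
      using assms(1) by (intro power_strict_mono) auto
    also have "\<dots> \<le> hom_density F G"
      unfolding p_def a_def k_def G by (rule hom_density_ge_chain_density[OF assms(2) V(1) n(2) r(1,3)])
    finally show False
      using assms(6) unfolding k_def a_def by (simp add: power_mult)
  qed
  define H where "H = comparability_graph_of V (level_cut V r m l)"
  have poset': "strict_poset V (level_cut V r m l)"
    by (rule strict_poset_level_cut[OF V(1) poset])
  then have "irrefl (level_cut V r m l)"
    unfolding strict_poset_def by blast
  then have "simple_graph H"
    unfolding H_def simple_graph_def comparability_graph_of_def irrefl_def
    by (auto simp: card_insert_if)
  moreover have "edges H \<subseteq> edges G"
    unfolding H_def G comparability_graph_of_def using level_cut_subset[of V r m l] by auto
  ultimately have "spanning_subgraph H G"
    unfolding spanning_subgraph_def subgraph_def V H_def by (simp add: comparability_graph_of_def)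
  moreover have "comparability_graph H"
    unfolding comparability_graph_def H_def using poset' by blast
  moreover obtain h where h: "proper_colouring H l h"
    unfolding H_def using proper_colouring_level_cut[OF V(1) poset l(2)] by blast
  have "graph_free F H"
    unfolding graph_free_def
  proof
    assume "\<exists>H'. subgraph H' H \<and> isomorphic F H'"
    then obtain c where "proper_colouring F l c"
      using proper_colouring_pullback[OF h] assms(2) unfolding finite_graph_def by blast
    then show False using chromatic_number_le l unfolding k_def by fastforce
  qed
  moreover have "graph_free (complete_graph k) H"
    unfolding graph_free_def
  proof
    assume "\<exists>H'. subgraph H' H \<and> isomorphic (complete_graph k) H'"
    moreover have "simple_graph (complete_graph k)"
      unfolding simple_graph_def complete_graph_def by simp
    ultimately obtain c where "proper_colouring (complete_graph k) l c"
      using proper_colouring_pullback[OF h] by blast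
    then show False using proper_colouring_complete_graph l by fastforce
  qed
  moreover have "real (card (edges G - edges H)) \<le> \<epsilon> * (real (card (verts G)))\<^sup>2"
  proof -
    have "finite r" using r(1) V(1) by (meson finite_SigmaI finite_subset)
    moreover have "edges G - edges H \<subseteq> (\<lambda>(u, v). {u, v}) ` (r - level_cut V r m l)"
      unfolding G H_def comparability_graph_of_def using r(1) by (force simp: insert_commute)
    ultimately have "card (edges G - edges H) \<le> card (r - level_cut V r m l)"
      by (intro surj_card_le) auto
    also have "real \<dots> \<le> 2 * m * real (card V)"
      by (rule card_removed_by_level_cut[OF V(1) r(1,3) m few])
    finally show ?thesis
      by (simp add: m_def V power2_eq_square)
  qed
  ultimately show ?thesis
    unfolding k_def by blast
qed

end
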